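(* Let $n\ge 2$ be an integer with prime factorisation $n=\prod_{i=1}^m \varphi_i^{a_i}$ where $\varphi_1<\varphi_2<\dots<\varphi_m$ are primes and $a_i\ge 1$, and let $x>1$ be an integer; let $\omega_n$ be the number of distinct prime factors of $x^n-1$. Fix $\alpha\in\{1,\dots,m\}$, let $\tau$ be the index with $\varphi_\alpha\in\Pi_n^\tau$ and $b$ the index with $\varphi_\alpha=r_{b,\tau}$. For a tuple $(k_0,\dots,k_m)$ define $\delta_\alpha(j)$, $j\in\{0,\dots,m\}$, as follows. If $\varphi_\alpha\mid x^n-1$: $\delta_\alpha(\tau)=\varphi_\alpha/r_{k_\tau,\tau}$ if $k_\tau<b$, $\delta_\alpha(\alpha)=\varphi_\alpha^{a_\alpha}$, and $\delta_\alpha(j)=1$ in all other cases. If $\varphi_\alpha\nmid x^n-1$: $\delta_\alpha(\tau)=r_{k_\tau+1,\tau}/\varphi_\alpha$ if $k_\tau\ge b$, and $\delta_\alpha(j)=1$ in all other cases. Then $$x\;\ge\;\min\left[\,\max\left\{\left(1+\prod_{j=0}^{t}\delta_\alpha(j)\prod_{i=1}^{k_j} r_{i,j}\right)^{T(t)}\;\middle|\; t\in\{0,\dots,m\}\right\}\;\middle|\;(k_0,\dots,k_m)\in\mathbb{Z}_{\ge0}^{m+1},\ \sum_{s=0}^m k_s=\omega_n\right],$$ where in the minimum only those tuples are admitted for which every prime $r_{i,j}$ occurring in the expression (including in $\delta_\alpha$) is defined, i.e. $1\le i\le|\Pi_n^j|$.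
   Context: Set $\varphi_0:=1$. For $j\in\{0,\dots,m\}$ let $\Pi_n^j$ be the set of primes $\rho$ with $\rho\equiv1\pmod{\varphi_j}$ and $\rho\not\equiv1\pmod{\varphi_i}$ for all $i$ with $j<i\le m$ (vacuous first condition for $j=0$); these partition the primes. $r_{i,j}$ is the $i$-th smallest element of $\Pi_n^j$. $T(t)=\prod_{k=1}^t\varphi_k^{-a_k}$. Empty products equal $1$. (One has $\tau<\alpha$.) *)

theory Defs
  imports Complex_Main "HOL-Number_Theory.Number_Theory" "HOL-Library.Infinite_Set"
    "HOL-Library.FuncSet"
begin

text \<open>
  Throughout, \<open>\<phi> 1 < \<dots> < \<phi> m\<close> are the prime factors of \<open>n\<close>, with exponents \<open>a 1, \<dots>, a m\<close>,
  and \<open>\<phi> 0 = 1\<close>, which makes the first congruence below vacuous for \<open>j = 0\<close>.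
\<close>

definition prime_class :: "(nat \<Rightarrow> nat) \<Rightarrow> nat \<Rightarrow> nat \<Rightarrow> nat set" where
  "prime_class \<phi> m j =
     {\<rho>. prime \<rho> \<and> [\<rho> = 1] (mod \<phi> j) \<and> (\<forall>i. j < i \<and> i \<le> m \<longrightarrow> \<not> [\<rho> = 1] (mod \<phi> i))}"

text \<open>
  The \<open>i\<close>-th smallest element \<open>r\<^bsub>i,j\<^esub>\<close> of the \<open>j\<close>-th class, counting from 1. It is meaningful only
  if \<open>1 \<le> i \<le> |prime_class \<phi> m j|\<close>, which is what \<open>class_index\<close> says; the class may be finite (it
  is \<open>{2}\<close> if \<open>n\<close> is even and \<open>j = 0\<close>) or infinite, and \<^const>\<open>card\<close> is 0 on infinite sets.
\<close>

definition class_prime :: "(nat \<Rightarrow> nat) \<Rightarrow> nat \<Rightarrow> nat \<Rightarrow> nat \<Rightarrow> nat" where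
  "class_prime \<phi> m i j = enumerate (prime_class \<phi> m j) (i - 1)"

definition class_index :: "(nat \<Rightarrow> nat) \<Rightarrow> nat \<Rightarrow> nat \<Rightarrow> nat \<Rightarrow> bool" where
  "class_index \<phi> m i j \<longleftrightarrow>
     1 \<le> i \<and> (finite (prime_class \<phi> m j) \<longrightarrow> i \<le> card (prime_class \<phi> m j))"

definition T :: "(nat \<Rightarrow> nat) \<Rightarrow> (nat \<Rightarrow> nat) \<Rightarrow> nat \<Rightarrow> real" where
  "T \<phi> a t = (\<Prod>k=1..t. inverse (real (\<phi> k) ^ a k))"

text \<open>
  The argument \<open>D\<close> is the truth value of \<open>\<phi> \<alpha> dvd x ^ n - 1\<close>. Since \<open>\<tau> < \<alpha>\<close> whenever \<open>\<phi> \<alpha>\<close> lies in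
  class \<open>\<tau>\<close>, the order of the tests on \<open>j\<close> is immaterial.
\<close>

definition delta ::
  "(nat \<Rightarrow> nat) \<Rightarrow> (nat \<Rightarrow> nat) \<Rightarrow> nat \<Rightarrow> bool \<Rightarrow> nat \<Rightarrow> nat \<Rightarrow> nat \<Rightarrow> (nat \<Rightarrow> nat) \<Rightarrow> nat \<Rightarrow> real" where
  "delta \<phi> a m D \<alpha> \<tau> b k j =
     (if D then
        (if j = \<tau> \<and> k \<tau> < b then real (\<phi> \<alpha>) / real (class_prime \<phi> m (k \<tau>) \<tau>)
         else if j = \<alpha> then real (\<phi> \<alpha>) ^ a \<alpha>
         else 1)
      else
        (if j = \<tau> \<and> k \<tau> \<ge> b then real (class_prime \<phi> m (k \<tau> + 1) \<tau>) / real (\<phi> \<alpha>)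
         else 1))"

text \<open>
  All \<open>r\<^bsub>i,j\<^esub>\<close> occurring for the tuple \<open>k\<close> are defined: those in the products, and the one in
  \<^const>\<open>delta\<close> in the cases where it occurs there. In particular, if \<open>D\<close> holds then
  \<open>k \<tau> = 0\<close> is excluded, as it would require \<open>r\<^bsub>0,\<tau>\<^esub>\<close>.
\<close>

definition admitted ::
  "(nat \<Rightarrow> nat) \<Rightarrow> nat \<Rightarrow> bool \<Rightarrow> nat \<Rightarrow> nat \<Rightarrow> (nat \<Rightarrow> nat) \<Rightarrow> bool" where
  "admitted \<phi> m D \<tau> b k \<longleftrightarrow>
     (\<forall>j\<in>{0..m}. \<forall>i\<in>{1..k j}. class_index \<phi> m i j) \<and>
     (D \<and> k \<tau> < b \<longrightarrow> class_index \<phi> m (k \<tau>) \<tau>) \<and>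
     (\<not> D \<and> k \<tau> \<ge> b \<longrightarrow> class_index \<phi> m (k \<tau> + 1) \<tau>)"

end

theory Submission
  imports Defs
begin

text \<open>
  The minimum is bounded by the tuple in which \<open>k j\<close> counts the prime factors of \<open>x ^ n - 1\<close> in
  class \<open>j\<close>. If such a prime \<open>p\<close> lies in class \<open>j \<le> t\<close>, then the order of \<open>x\<close> modulo \<open>p\<close> divides both
  \<open>n\<close> and \<open>p - 1\<close>, hence is coprime to \<open>\<phi> i\<close> for \<open>i > t\<close>, so \<open>p\<close> divides \<open>x ^ N - 1\<close> with
  \<open>N = \<Prod>k=1..t. \<phi> k ^ a k = 1 / T t\<close>. The product of these primes is therefore at most \<open>x ^ N - 1\<close>,
  and it only decreases if the primes of each class are replaced by the smallest ones. Knowing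
  whether \<open>\<phi> \<alpha>\<close> is among them sharpens this replacement in class \<open>\<tau>\<close>; and if it is, then lifting
  the exponent yields the additional factor \<open>\<phi> \<alpha> ^ a \<alpha>\<close> as soon as \<open>t \<ge> \<alpha>\<close>.
\<close>

section \<open>Products of smallest elements\<close>

text \<open>The least element of \<open>S\<close> is at most \<open>Min A\<close>. Removing both
  preserves the inclusion, because every remaining element of \<open>A\<close> exceeds
  \<open>Min A\<close>, so induction on \<open>card A\<close> applies. Only the first
  \<open>card A\<close> values of \<open>enumerate\<close> occur, so finite and infinite
  \<open>S\<close> are treated alike.\<close>

lemma prod_enumerate_le_prod:
  fixes S A :: "nat set"
  assumes "finite A" "A \<subseteq> S"
  shows "(\<Prod>i<card A. enumerate S i) \<le> \<Prod>A"
  using assms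
proof (induction "card A" arbitrary: A S)
  case 0
  then show ?case by simp
next
  case (Suc k)
  define l where "l = (LEAST n. n \<in> S)"
  define c where "c = Min A"
  have ne: "A \<noteq> {}" using Suc.hyps(2) by auto
  have c: "c \<in> A" using ne Suc.prems by (simp add: c_def)
  have "l \<le> c" using c Suc.prems unfolding l_def by (auto intro: Least_le)
  have sub: "A - {c} \<subseteq> S - {l}"
  proof
    fix y assume y: "y \<in> A - {c}"
    then have "c \<le> y" using Suc.prems by (simp add: c_def)
    with y \<open>l \<le> c\<close> Suc.prems show "y \<in> S - {l}" by auto
  qed
  have card: "card (A - {c}) = k" using Suc.hyps(2) Suc.prems c by simp
  have "(\<Prod>i<card A. enumerate S i) = l * (\<Prod>i<k. enumerate (S - {l}) i)"
    unfolding Suc.hyps(2)[symmetric] prod.lessThan_Suc_shift l_def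
    by (simp add: enumerate_0 enumerate_Suc)
  also have "\<dots> \<le> c * \<Prod>(A - {c})"
    using Suc.hyps(1)[of "A - {c}" "S - {l}"] card sub Suc.prems \<open>l \<le> c\<close>
    by (intro mult_mono) auto
  also have "\<dots> = \<Prod>A" using c Suc.prems by (simp add: prod.remove)
  finally show ?case .
qed

section \<open>Divisibility of powers minus one\<close>

text \<open>Each p-th power gains one factor p: in z^p - 1 = (z - 1)(1 + z + ... + z^(p-1)) the
  second factor has p summands congruent to 1 modulo p. This half of lifting the exponent has no
  exception at p = 2.\<close>

lemma prime_power_dvd_power_minus_one:
  fixes p y s :: nat
  assumes "p dvd y - 1" "y \<ge> 1"
  shows "p ^ Suc s dvd y ^ (p ^ s) - 1"
proof -
  \<comment> \<open>Over the integers the factorisation of z^p - 1 avoids truncated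
    subtraction.\<close>
  have *: "int p ^ Suc s dvd int y ^ (p ^ s) - 1"
  proof (induction s)
    case 0
    have "int p dvd int (y - 1)" using assms(1) by (simp only: of_nat_dvd_iff)
    then show ?case using assms(2) by (simp add: of_nat_diff)
  next
    case (Suc s)
    define z where "z = int y ^ (p ^ s)"
    have z1: "[z = 1] (mod int p)"
      using Suc dvd_trans[of "int p" "int p ^ Suc s" "z - 1"] by (simp add: z_def cong_iff_dvd_diff)
    have "[(\<Sum>i<p. z ^ i) = (\<Sum>i<p. 1 ^ i)] (mod int p)"
      by (intro cong_sum cong_pow z1)
    then have "int p dvd (\<Sum>i<p. z ^ i)"
      by (simp add: cong_def dvd_eq_mod_eq_0)
    moreover have "int p ^ Suc s dvd z - 1" using Suc by (simp add: z_def)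
    ultimately have "int p ^ Suc s * int p dvd (z - 1) * (\<Sum>i<p. z ^ i)"
      by (rule mult_dvd_mono[rotated])
    also have "(z - 1) * (\<Sum>i<p. z ^ i) = z ^ p - 1" by (simp add: power_diff_1_eq)
    also have "z ^ p = int y ^ (p ^ Suc s)" by (simp add: z_def power_mult[symmetric] mult.commute)
    finally show ?case by (simp add: mult.commute)
  qed
  have "int (y ^ (p ^ s) - 1) = int y ^ (p ^ s) - 1"
    using assms by (simp add: of_nat_diff)
  with * show ?thesis by (metis of_nat_dvd_iff of_nat_power)
qed

lemma cong_one_iff_dvd_minus_one:
  fixes y d :: nat
  assumes "y \<ge> 1"
  shows "[y = 1] (mod d) \<longleftrightarrow> d dvd y - 1"
  using assms by (simp add: cong_altdef_nat)

lemma prime_dvd_power_minus_one_coprime_cofactor: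
  fixes p x M N :: nat
  assumes "prime p" "x \<ge> 1" "N * M > 0" "p dvd x ^ (N * M) - 1" "coprime (p - 1) M"
  shows "p dvd x ^ N - 1"
proof -
  have "[x ^ (N * M) = 1] (mod p)"
    using assms by (subst cong_one_iff_dvd_minus_one) auto
  then have ord_NM: "ord p x dvd N * M" by (simp add: ord_divides')
  \<comment> \<open>\<open>ord p x\<close> is 0 unless \<open>p\<close> and \<open>x\<close> are
    coprime, and 0 does not divide the positive number \<open>N * M\<close>.\<close>
  with assms(3) have "coprime p x" by (metis dvd_0_left_iff neq0_conv ord_eq_0)
  then have "ord p x dvd p - 1"
    using order_divides_totient[of p x] assms(1) by (simp add: totient_prime)
  then have "coprime (ord p x) M" using assms(5) by (rule coprime_divisors[OF _ dvd_refl])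
  then have "ord p x dvd N" using ord_NM by (simp add: coprime_dvd_mult_left_iff)
  then have "[x ^ N = 1] (mod p)" by (simp add: ord_divides')
  then show ?thesis using assms(2) cong_one_iff_dvd_minus_one by simp
qed

lemma prod_primes_dvd:
  fixes A :: "nat set"
  assumes "finite A" "\<And>p. p \<in> A \<Longrightarrow> prime p" "\<And>p. p \<in> A \<Longrightarrow> p dvd y"
  shows "\<Prod>A dvd y"
  using assms
proof (induction A rule: finite_induct)
  case empty
  then show ?case by simp
next
  case (insert q A)
  have "coprime q (\<Prod>A)"
    using insert by (intro prod_coprime_right primes_coprime) auto
  then show ?case using insert by (simp add: divides_mult)
qed

section \<open>The prime classes\<close>

lemma prime_class_disjoint:
  assumes "i \<in> {0..m}" "j \<in> {0..m}" "i \<noteq> j"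
  shows "prime_class \<phi> m i \<inter> prime_class \<phi> m j = {}"
  using assms unfolding prime_class_def by (cases "i < j") (auto simp: not_less)

text \<open>The class of \<open>p\<close> is given by the largest index \<open>j\<close> with
  \<open>p\<close> congruent to 1 modulo \<open>\<phi> j\<close>; index 0 always qualifies since
  \<open>\<phi> 0 = 1\<close>.\<close>

lemma prime_in_some_prime_class:
  assumes "prime p" "\<phi> 0 = 1"
  obtains j where "j \<in> {0..m}" "p \<in> prime_class \<phi> m j"
proof -
  define J where "J = {j \<in> {0..m}. [p = 1] (mod \<phi> j)}"
  have fin: "finite J" and "0 \<in> J" using assms by (auto simp: J_def)
  then have J: "Max J \<in> J" by (intro Max_in) auto
  have "\<not> [p = 1] (mod \<phi> i)" if "Max J < i" "i \<le> m" for i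
  proof
    assume "[p = 1] (mod \<phi> i)"
    then have "i \<in> J" using that by (simp add: J_def)
    then show False using fin that by (meson Max_ge leD)
  qed
  then have "p \<in> prime_class \<phi> m (Max J)" using J assms(1) unfolding prime_class_def J_def by blast
  moreover have "Max J \<in> {0..m}" using J unfolding J_def by blast
  ultimately show ?thesis using that by blast
qed

text \<open>Otherwise \<open>\<phi> \<tau>\<close> would be at least \<open>\<phi> \<alpha>\<close>
  and yet divide the smaller positive number \<open>\<phi> \<alpha> - 1\<close>.\<close>

lemma prime_class_index_less:
  assumes "\<And>i. i \<in> {1..m} \<Longrightarrow> prime (\<phi> i)" "strict_mono_on {1..m} \<phi>"
    and "\<alpha> \<in> {1..m}" "\<tau> \<in> {0..m}" "\<phi> \<alpha> \<in> prime_class \<phi> m \<tau>"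
  shows "\<tau> < \<alpha>"
proof (rule ccontr)
  assume "\<not> \<tau> < \<alpha>"
  then have le: "\<alpha> \<le> \<tau>" and \<tau>: "\<tau> \<in> {1..m}" using assms by auto
  have "\<phi> \<alpha> \<le> \<phi> \<tau>"
    using assms(2,3) \<tau> le by (metis le_neq_implies_less order.refl order.strict_implies_order strict_mono_onD)
  moreover have "\<phi> \<alpha> > 1" using assms(1)[OF assms(3)] by (rule prime_gt_1_nat)
  moreover have "\<phi> \<tau> dvd \<phi> \<alpha> - 1"
    using assms(5) \<open>\<phi> \<alpha> > 1\<close> cong_one_iff_dvd_minus_one[of "\<phi> \<alpha>" "\<phi> \<tau>"]
    by (auto simp: prime_class_def)
  ultimately show False using dvd_imp_le[of "\<phi> \<tau>" "\<phi> \<alpha> - 1"] by simp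
qed

lemma prod_class_prime_le_prod:
  assumes "finite A" "A \<subseteq> prime_class \<phi> m j"
  shows "(\<Prod>i=1..card A. class_prime \<phi> m i j) \<le> \<Prod>A"
  using prod_enumerate_le_prod[OF assms] by (simp add: class_prime_def prod.atLeast1_atMost_eq)

lemma class_index_subset:
  assumes "A \<subseteq> prime_class \<phi> m j" "1 \<le> i" "i \<le> card A"
  shows "class_index \<phi> m i j"
  using assms unfolding class_index_def by (meson card_mono order.trans)

theorem theorem1p2:
  fixes n m x \<alpha> \<tau> b \<omega> :: nat and \<phi> a :: "nat \<Rightarrow> nat"
  assumes "n \<ge> 2"
    and "\<phi> 0 = 1"
    and "\<And>i. i \<in> {1..m} \<Longrightarrow> prime (\<phi> i)"
    and "strict_mono_on {1..m} \<phi>"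
    and "\<And>i. i \<in> {1..m} \<Longrightarrow> a i \<ge> 1"
    and "n = (\<Prod>i=1..m. \<phi> i ^ a i)"
    and "x > 1"
    and "\<omega> = card (prime_factors (x ^ n - 1))"
    and "\<alpha> \<in> {1..m}"
    and "\<tau> \<in> {0..m}" and "\<phi> \<alpha> \<in> prime_class \<phi> m \<tau>"
    and "class_index \<phi> m b \<tau>" and "\<phi> \<alpha> = class_prime \<phi> m b \<tau>"
  shows "real x \<ge>
    Min {Max {(1 + (\<Prod>j=0..t. delta \<phi> a m (\<phi> \<alpha> dvd x ^ n - 1) \<alpha> \<tau> b k j *
                        (\<Prod>i=1..k j. real (class_prime \<phi> m i j)))) powr T \<phi> a t
              | t. t \<in> {0..m}}
         | k. k \<in> {0..m} \<rightarrow>\<^sub>E (UNIV :: nat set) \<and> (\<Sum>s=0..m. k s) = \<omega> \<and>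
              admitted \<phi> m (\<phi> \<alpha> dvd x ^ n - 1) \<tau> b k}"
proof -

  \<comment> \<open>The tuple of prime factor counts\<close>
  define D where "D \<longleftrightarrow> \<phi> \<alpha> dvd x ^ n - 1"
  define X where "X = x ^ n - 1"
  define P where "P j = prime_factors X \<inter> prime_class \<phi> m j" for j
  \<comment> \<open>The restriction to \<open>{0..m}\<close> makes \<open>k\<close> extensional, as
    the tuples under the minimum are.\<close>
  define k where "k = (\<lambda>j\<in>{0..m}. card (P j))"
  define N where "N t = (\<Prod>i=1..t. \<phi> i ^ a i)" for t
  define q where "q = \<phi> \<alpha>"
  have q: "prime q" using assms(3)[OF assms(9)] by (simp add: q_def)
  have \<tau>\<alpha>: "\<tau> < \<alpha>" using prime_class_index_less assms(3,4,9-11) by blast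
  have X0: "X \<noteq> 0"
  proof -
    have "x ^ n > 1" using assms(1,7) by (intro one_less_power) auto
    then show ?thesis by (simp add: X_def)
  qed
  have finP: "finite (P j)" for j by (simp add: P_def)
  have P_class: "P j \<subseteq> prime_class \<phi> m j" for j by (simp add: P_def)
  have P_prime: "prime p" if "p \<in> P j" for p j using that by (auto simp: P_def)
  have P_disj: "P i \<inter> P j = {}" if "i \<in> {0..m}" "j \<in> {0..m}" "i \<noteq> j" for i j
    using prime_class_disjoint[OF that, of \<phi>] by (auto simp: P_def)
  have q_in: "q \<in> P \<tau> \<longleftrightarrow> D"
    using assms(11) q X0 by (auto simp: P_def D_def q_def X_def prime_factors_dvd)
  have \<phi>_pos: "\<phi> i > 0" if "i \<in> {1..m}" for i using assms(3)[OF that] prime_gt_0_nat by blast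
  have N_pos: "N t > 0" if "t \<le> m" for t
    using that \<phi>_pos by (auto simp: N_def intro!: prod_pos)

  \<comment> \<open>Divisors of \<open>x ^ N t - 1\<close>\<close>
  have dvd_N: "p dvd x ^ N t - 1" if p: "p \<in> P j" and jt: "j \<le> t" and tm: "t \<le> m" for p j t
  proof (rule prime_dvd_power_minus_one_coprime_cofactor)
    define M where "M = (\<Prod>i=t+1..m. \<phi> i ^ a i)"
    have n: "n = N t * M"
      using prod.ub_add_nat[of 1 t "\<lambda>i. \<phi> i ^ a i" "m - t"] assms(6) tm by (simp add: N_def M_def)
    show "prime p" using p by (rule P_prime)
    show "x \<ge> 1" using assms(7) by simp
    show "N t * M > 0" using n assms(1) by linarith
    show "p dvd x ^ (N t * M) - 1" using p by (auto simp: P_def X_def n)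
    have "coprime (p - 1) (\<phi> i ^ a i)" if i: "i \<in> {t+1..m}" for i
    proof -
      have "\<not> [p = 1] (mod \<phi> i)" using p i jt by (auto simp: P_def prime_class_def)
      then have "\<not> \<phi> i dvd p - 1"
        using cong_one_iff_dvd_minus_one[of p "\<phi> i"] prime_ge_1_nat[OF P_prime[OF p]] by simp
      moreover have "prime (\<phi> i)" using i assms(3) by simp
      ultimately have "coprime (\<phi> i) (p - 1)" by (intro prime_imp_coprime)
      then show ?thesis by (simp add: coprime_commute)
    qed
    then show "coprime (p - 1) M" unfolding M_def by (intro prod_coprime_right) auto
  qed

  have le_N: "(\<Prod>j=0..t. \<Prod>(P j)) * (if D \<and> \<alpha> \<le> t then q ^ a \<alpha> else 1) \<le> x ^ N t - 1"
    if tm: "t \<le> m" for t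
  proof (rule dvd_imp_le)
    define Q where "Q = (\<Union>j\<in>{0..t}. P j)"
    have finQ: "finite Q" by (simp add: Q_def finP)
    have Q_prime: "prime p" and Q_dvd: "p dvd x ^ N t - 1" if "p \<in> Q" for p
      using that P_prime dvd_N tm by (auto simp: Q_def)
    have Q: "(\<Prod>j=0..t. \<Prod>(P j)) = \<Prod>Q"
      unfolding Q_def using P_disj tm finP by (subst prod.UNION_disjoint) auto
    show "(\<Prod>j=0..t. \<Prod>(P j)) * (if D \<and> \<alpha> \<le> t then q ^ a \<alpha> else 1) dvd x ^ N t - 1"
    proof (cases "D \<and> \<alpha> \<le> t")
      case False
      then show ?thesis unfolding Q using prod_primes_dvd[of Q] finQ Q_prime Q_dvd by auto
    next
      case True
      have qQ: "q \<in> Q" using True q_in \<tau>\<alpha> by (auto simp: Q_def intro!: bexI[of _ \<tau>])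
      \<comment> \<open>As \<tau> < \<alpha>, the prime \<open>q\<close> already divides at level
        \<open>\<alpha> - 1\<close>; passing to \<open>N \<alpha>\<close> raises to the power
        \<open>q ^ a \<alpha>\<close> and gains \<open>a \<alpha>\<close> further factors
        \<open>q\<close>.\<close>
      have "q dvd x ^ N (\<alpha> - 1) - 1"
        using dvd_N[of q \<tau> "\<alpha> - 1"] True q_in \<tau>\<alpha> assms(9) by auto
      then have "q ^ Suc (a \<alpha>) dvd (x ^ N (\<alpha> - 1)) ^ (q ^ a \<alpha>) - 1"
        using assms(7) by (intro prime_power_dvd_power_minus_one) auto
      also have "(x ^ N (\<alpha> - 1)) ^ (q ^ a \<alpha>) = x ^ N \<alpha>"
      proof -
        have "N \<alpha> = N (\<alpha> - 1) * q ^ a \<alpha>"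
          using assms(9) by (cases \<alpha>) (auto simp: N_def q_def)
        then show ?thesis by (simp add: power_mult)
      qed
      also have "x ^ N \<alpha> - 1 dvd x ^ N t - 1"
      proof -
        have "N t = N \<alpha> * (\<Prod>i=\<alpha>+1..t. \<phi> i ^ a i)"
          using prod.ub_add_nat[of 1 \<alpha> "\<lambda>i. \<phi> i ^ a i" "t - \<alpha>"] True by (simp add: N_def)
        moreover have "[(x ^ N \<alpha>) ^ c = 1 ^ c] (mod x ^ N \<alpha> - 1)" for c
          using assms(7) by (intro cong_pow) (simp add: cong_altdef_nat)
        ultimately show ?thesis
          using assms(7) cong_one_iff_dvd_minus_one[of "x ^ N t" "x ^ N \<alpha> - 1"]
          by (simp add: power_mult)
      qed
      finally have q_dvd: "q ^ Suc (a \<alpha>) dvd x ^ N t - 1" .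
      \<comment> \<open>With \<open>q\<close> removed, the product is coprime to the power of
        \<open>q\<close>; the factor \<open>q\<close> of \<open>\<Prod>Q\<close> accounts for the
        \<open>Suc\<close> in the exponent.\<close>
      have "\<Prod>(Q - {q}) dvd x ^ N t - 1"
        using finQ Q_prime Q_dvd by (intro prod_primes_dvd) auto
      moreover have "coprime (q ^ Suc (a \<alpha>)) (\<Prod>(Q - {q}))"
        using q Q_prime by (intro prod_coprime_right coprime_power_left_iff[THEN iffD2] disjI1 primes_coprime) auto
      ultimately have "q ^ Suc (a \<alpha>) * \<Prod>(Q - {q}) dvd x ^ N t - 1"
        using q_dvd by (intro divides_mult)
      also have "q ^ Suc (a \<alpha>) * \<Prod>(Q - {q}) = \<Prod>Q * q ^ a \<alpha>"
        using finQ qQ by (simp add: prod.remove[of Q q])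
      finally show ?thesis using True by (simp add: Q)
    qed
    have "x ^ N t > 1" using assms(7) N_pos[OF tm] by (intro one_less_power) auto
    then show "x ^ N t - 1 > 0" by simp
  qed

  \<comment> \<open>Estimates class by class\<close>
  have k_card: "k j = card (P j)" if "j \<in> {0..m}" for j using that by (simp add: k_def)

  have term_le: "delta \<phi> a m D \<alpha> \<tau> b k j * (\<Prod>i=1..k j. real (class_prime \<phi> m i j))
      \<le> real (\<Prod>(P j)) * (if j = \<alpha> then if D then real q ^ a \<alpha> else 1 else 1)"
    if j: "j \<in> {0..m}" for j
  proof -
    have generic: "(\<Prod>i=1..k j. real (class_prime \<phi> m i j)) \<le> real (\<Prod>(P j))"
      using prod_class_prime_le_prod[OF finP P_class, of j] j
      by (simp add: k_card flip: of_nat_prod)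
    have "q \<ge> 1" using q prime_ge_1_nat by blast
    consider (less) "D" "j = \<tau>" "k \<tau> < b" | (ge) "\<not> D" "j = \<tau>" "k \<tau> \<ge> b"
      | (other) "\<not> (D \<and> j = \<tau> \<and> k \<tau> < b)" "\<not> (\<not> D \<and> j = \<tau> \<and> k \<tau> \<ge> b)" by blast
    then show ?thesis
    proof cases
      case less
      define r where "r = class_prime \<phi> m (k \<tau>) \<tau>"
      have qP: "q \<in> P \<tau>" using less q_in by simp
      \<comment> \<open>One of the \<open>k \<tau>\<close> primes is \<open>q\<close> itself, so
        only the other \<open>l\<close> are replaced by the smallest ones; \<open>q / r\<close>
        exchanges the last factor of the product for \<open>q\<close>.\<close>
      then obtain l where l: "k \<tau> = Suc l"
        using k_card[OF assms(10)] finP by (metis card_0_eq empty_iff not0_implies_Suc)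
      have "card (P \<tau> - {q}) = l" using l k_card[OF assms(10)] qP finP by simp
      then have "(\<Prod>i=1..l. class_prime \<phi> m i \<tau>) \<le> \<Prod>(P \<tau> - {q})"
        using prod_class_prime_le_prod[of "P \<tau> - {q}" \<phi> m \<tau>] finP P_class by auto
      then have "q * (\<Prod>i=1..l. class_prime \<phi> m i \<tau>) \<le> \<Prod>(P \<tau>)"
        using qP finP by (simp add: prod.remove)
      then have "real q * (\<Prod>i=1..l. real (class_prime \<phi> m i \<tau>)) \<le> real (\<Prod>(P \<tau>))"
        by (simp flip: of_nat_prod of_nat_mult)
      \<comment> \<open>Stated as an inequality, this also covers \<open>r = 0\<close>, where the
        left side vanishes.\<close>
      moreover have "real q / real r * (\<Prod>i=1..k \<tau>. real (class_prime \<phi> m i \<tau>))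
          \<le> real q * (\<Prod>i=1..l. real (class_prime \<phi> m i \<tau>))"
        unfolding r_def l by (auto simp: prod_nonneg)
      ultimately show ?thesis using less \<tau>\<alpha> by (simp add: delta_def q_def r_def)
    next
      case ge
      \<comment> \<open>Adjoining \<open>q\<close> gives \<open>k \<tau> + 1\<close> primes of the
        class, to be compared with the first \<open>k \<tau> + 1\<close>; dividing by
        \<open>q\<close> then produces the factor in \<open>delta\<close>.\<close>
      have qP: "q \<notin> P \<tau>" using ge q_in by simp
      have "card (insert q (P \<tau>)) = Suc (k \<tau>)" using k_card[OF assms(10)] qP finP by simp
      then have "(\<Prod>i=1..Suc (k \<tau>). class_prime \<phi> m i \<tau>) \<le> \<Prod>(insert q (P \<tau>))"
        using prod_class_prime_le_prod[of "insert q (P \<tau>)" \<phi> m \<tau>] finP P_class assms(11)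
        by (auto simp: q_def)
      also have "\<Prod>(insert q (P \<tau>)) = q * \<Prod>(P \<tau>)" using qP finP by simp
      finally have "(\<Prod>i=1..Suc (k \<tau>). real (class_prime \<phi> m i \<tau>)) \<le> real q * real (\<Prod>(P \<tau>))"
        by (simp flip: of_nat_prod of_nat_mult)
      then have "real (class_prime \<phi> m (k \<tau> + 1) \<tau>) / real q * (\<Prod>i=1..k \<tau>. real (class_prime \<phi> m i \<tau>))
          \<le> real (\<Prod>(P \<tau>))"
        using \<open>q \<ge> 1\<close> by (simp add: field_simps)
      then show ?thesis using ge \<tau>\<alpha> by (simp add: delta_def q_def)
    next
      case other
      then have "delta \<phi> a m D \<alpha> \<tau> b k j = (if j = \<alpha> then if D then real q ^ a \<alpha> else 1 else 1)"
        by (auto simp: delta_def q_def)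
      then show ?thesis
        using generic \<open>q \<ge> 1\<close> by (auto simp: mult.commute intro: mult_left_mono)
    qed
  qed

  \<comment> \<open>The bound for a single \<open>t\<close>\<close>
  have main: "(1 + (\<Prod>j=0..t. delta \<phi> a m D \<alpha> \<tau> b k j *
      (\<Prod>i=1..k j. real (class_prime \<phi> m i j)))) powr T \<phi> a t \<le> real x"
    if "t \<in> {0..m}" for t
  proof -
    let ?f = "\<lambda>j. delta \<phi> a m D \<alpha> \<tau> b k j * (\<Prod>i=1..k j. real (class_prime \<phi> m i j))"
    have tm: "t \<le> m" using that by simp
    have nonneg: "?f j \<ge> 0" for j by (intro mult_nonneg_nonneg prod_nonneg) (auto simp: delta_def)
    have "(\<Prod>j=0..t. ?f j) \<le> (\<Prod>j=0..t. real (\<Prod>(P j)) * (if j = \<alpha> then if D then real q ^ a \<alpha> else 1 else 1))"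
      using term_le nonneg tm by (intro prod_mono) auto
    \<comment> \<open>The extra factor sits at index \<alpha> alone, so it is present exactly when
      \<alpha> \<le> t.\<close>
    also have "\<dots> = real ((\<Prod>j=0..t. \<Prod>(P j)) * (if D \<and> \<alpha> \<le> t then q ^ a \<alpha> else 1))"
      by (simp add: prod.distrib prod.delta)
    also have "\<dots> \<le> real (x ^ N t - 1)" using le_N[OF tm] by (rule of_nat_mono)
    also have "\<dots> = real x ^ N t - 1" using assms(7) by (simp add: of_nat_diff)
    finally have le: "1 + (\<Prod>j=0..t. ?f j) \<le> real x ^ N t" by simp
    have T: "T \<phi> a t = 1 / real (N t)"
      by (simp add: T_def N_def prod_inversef[unfolded comp_def] divide_inverse)
    have "(1 + (\<Prod>j=0..t. ?f j)) powr T \<phi> a t \<le> (real x ^ N t) powr T \<phi> a t"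
      using le nonneg by (intro powr_mono2) (auto simp: T intro!: add_nonneg_nonneg prod_nonneg)
    also have "\<dots> = real x"
      using assms(7) N_pos[OF tm] by (simp add: T powr_powr flip: powr_realpow)
    finally show ?thesis .
  qed

  let ?g = "\<lambda>k. Max {(1 + (\<Prod>j=0..t. delta \<phi> a m D \<alpha> \<tau> b k j *
      (\<Prod>i=1..k j. real (class_prime \<phi> m i j)))) powr T \<phi> a t | t. t \<in> {0..m}}"
  let ?K = "{k. k \<in> {0..m} \<rightarrow>\<^sub>E (UNIV :: nat set) \<and> (\<Sum>s=0..m. k s) = \<omega> \<and> admitted \<phi> m D \<tau> b k}"
  \<comment> \<open>\<open>Min\<close> is a lower bound only for a finite set; the entries of a
    tuple are at most their sum \<omega>, and extensionality fixes the values outside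
    \<open>{0..m}\<close>.\<close>
  have fin: "finite ?K"
  proof (rule finite_subset)
    show "?K \<subseteq> {0..m} \<rightarrow>\<^sub>E {..\<omega>}"
      by (auto simp: PiE_iff extensional_def intro!: member_le_sum)
    show "finite ({0..m} \<rightarrow>\<^sub>E {..\<omega>})" by (intro finite_PiE) auto
  qed
  have "k \<in> ?K"
  proof (intro CollectI conjI)
    show "k \<in> {0..m} \<rightarrow>\<^sub>E (UNIV :: nat set)" by (simp add: k_def)
    have "prime_factors X = (\<Union>j\<in>{0..m}. P j)"
      using prime_in_some_prime_class[of _ \<phi> m] assms(2) by (auto simp: P_def) (metis in_prime_factors_imp_prime atLeastAtMost_iff le0)
    then have "\<omega> = card (\<Union>j\<in>{0..m}. P j)" using assms(8) by (simp add: X_def)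
    also have "\<dots> = (\<Sum>j\<in>{0..m}. card (P j))"
      using P_disj finP by (intro card_UN_disjoint) auto
    also have "\<dots> = (\<Sum>s=0..m. k s)" by (simp add: k_def)
    finally show "(\<Sum>s=0..m. k s) = \<omega>" by simp
    show "admitted \<phi> m D \<tau> b k" unfolding admitted_def
    proof (intro conjI ballI impI)
      fix j i assume "j \<in> {0..m}" "i \<in> {1..k j}"
      then show "class_index \<phi> m i j" using class_index_subset[OF P_class] k_card by auto
    next
      \<comment> \<open>Here \<open>q\<close> lies in \<open>P \<tau>\<close>, which rules out the
        undefined index 0.\<close>
      assume "D \<and> k \<tau> < b"
      then have "card (P \<tau>) \<ge> 1" using q_in finP by (metis One_nat_def Suc_leI card_gt_0_iff empty_iff)
      then show "class_index \<phi> m (k \<tau>) \<tau>" using class_index_subset[OF P_class] k_card[OF assms(10)] by auto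
    next
      \<comment> \<open>Here \<open>q\<close> is an element of the class outside
        \<open>P \<tau>\<close>, so index \<open>k \<tau> + 1\<close> exists.\<close>
      assume "\<not> D \<and> b \<le> k \<tau>"
      then have "card (insert q (P \<tau>)) = k \<tau> + 1" using q_in finP k_card[OF assms(10)] by simp
      moreover have "insert q (P \<tau>) \<subseteq> prime_class \<phi> m \<tau>" using P_class assms(11) by (simp add: q_def)
      ultimately show "class_index \<phi> m (k \<tau> + 1) \<tau>"
        using class_index_subset[of "insert q (P \<tau>)" \<phi> m \<tau> "k \<tau> + 1"] by simp
    qed
  qed
  then have "Min (?g ` ?K) \<le> ?g k" using fin by (intro Min_le) auto
  also have "?g k \<le> real x" using main by (subst Max_le_iff) auto
  finally show ?thesis unfolding D_def by (simp only: setcompr_eq_image)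
qed

end
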